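(* Let $\mathbb{T}$ be a time scale, $a,b\in\mathbb{T}$ with $a<b$, $t\in(a,b]_{\mathbb{T}}$, and $0\le\alpha\le 1$. Let $w,f,g\in C([a,b]_{\mathbb{T}},\mathbb{R})$ be diamond-$\alpha$ integrable functions and let $K:[a,b]_{\mathbb{T}}\times[a,b]_{\mathbb{T}}\to[0,\infty)$ be a nonnegative kernel. Assume that all the integrals appearing below exist and are finite. Suppose further that there exist constants $m,M>0$ such that \[ 0<m\leq\frac{|f(s)|}{|g(s)|}\leq M<\infty,\qquad s\in[a,t]_{\mathbb{T}} \] (in particular $g(s)\neq0$ for these $s$). Then \[ \mathcal{I}_{K}^{\alpha}(|w||f|^2)(t)\,\mathcal{I}_{K}^{\alpha}(|w||g|^2)(t)-\Big[\mathcal{I}_{K}^{\alpha}(|w||f||g|)(t)\Big]^2 \leq\frac12(M-m)^2\Big[\mathcal{I}_{K}^{\alpha}(|w||g|^2)(t)\Big]^2. \]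
   Context: A time scale $\mathbb{T}$ is a nonempty closed subset of $\mathbb{R}$. For $a,b\in\mathbb{T}$, $[a,b]_{\mathbb{T}}=[a,b]\cap\mathbb{T}$ and $(a,b]_{\mathbb{T}}=(a,b]\cap\mathbb{T}$. For $0\le\alpha\le1$ and $h$ delta and nabla integrable on $[a,b]_{\mathbb{T}}$, the diamond-$\alpha$ integral is \[ \int_a^b h(s)\diamond_\alpha s=\alpha\int_a^b h(s)\,\Delta s+(1-\alpha)\int_a^b h(s)\,\nabla s, \] where $\int\cdot\,\Delta s$ and $\int\cdot\,\nabla s$ are the usual delta and nabla integrals of time scale calculus. For a nonnegative kernel $K:[a,b]_{\mathbb{T}}\times[a,b]_{\mathbb{T}}\to[0,\infty)$ and a suitable function $h:[a,b]_{\mathbb{T}}\to\mathbb{R}$, the kernel-type diamond-$\alpha$ integral operator is \[ \mathcal{I}_{K}^{\alpha}h(t)=\int_a^t K(t,s)h(s)\diamond_\alpha s, \] provided that the integral exists and is finite. An expression such as $|w||f|^2$ denotes the function $s\mapsto|w(s)||f(s)|^2$. *)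

theory Defs
  imports "HOL-Analysis.Analysis"
begin

definition time_scale :: "real set \<Rightarrow> bool" where
  "time_scale T \<longleftrightarrow> T \<noteq> {} \<and> closed T"

text \<open>
  The delta and nabla integrals are the Lebesgue ones: integrals with respect to the
  Caratheodory extension of the interval length \<open>[c,d) \<mapsto> d - c\<close> (delta) resp.
  \<open>(c,d] \<mapsto> d - c\<close> (nabla), for \<open>c \<le> d\<close> in \<open>T\<close>. They extend the Riemann
  and the antiderivative versions of these integrals for nonnegative functions.

  The parameter \<open>J\<close> below is the type of half-open interval: \<open>atLeastLessThan\<close> for
  delta, \<open>greaterThanAtMost\<close> for nabla. A finite cover is a countable one padded with
  empty intervals. A set without countable cover (for delta, one that contains \<open>max T\<close>)
  gets the value \<open>\<infinity>\<close>, the infimum of the empty set.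
\<close>

definition ts_cover :: "(real \<Rightarrow> real \<Rightarrow> real set) \<Rightarrow> real set \<Rightarrow> real set \<Rightarrow> (nat \<Rightarrow> real \<times> real) set" where
  "ts_cover J T X = {p. (\<forall>i. fst (p i) \<in> T \<and> snd (p i) \<in> T \<and> fst (p i) \<le> snd (p i))
                        \<and> X \<subseteq> (\<Union>i. J (fst (p i)) (snd (p i)) \<inter> T)}"

definition ts_outer :: "(real \<Rightarrow> real \<Rightarrow> real set) \<Rightarrow> real set \<Rightarrow> real set \<Rightarrow> ennreal" where
  "ts_outer J T X = (INF p \<in> ts_cover J T X. \<Sum>i. ennreal (snd (p i) - fst (p i)))"

definition ts_measure :: "(real \<Rightarrow> real \<Rightarrow> real set) \<Rightarrow> real set \<Rightarrow> real measure" where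
  "ts_measure J T = measure_of T (lambda_system T (Pow T) (ts_outer J T)) (ts_outer J T)"

definition delta_measure :: "real set \<Rightarrow> real measure" where
  "delta_measure T = ts_measure atLeastLessThan T"

definition nabla_measure :: "real set \<Rightarrow> real measure" where
  "nabla_measure T = ts_measure greaterThanAtMost T"

text \<open>
  Functions on \<open>[a,b] \<inter> T\<close> are total functions on the reals; only their values on
  \<open>[a,b] \<inter> T\<close> matter. The integrals are meant for \<open>a, b \<in> T\<close> with \<open>a \<le> b\<close>.
\<close>

definition delta_integrable :: "real set \<Rightarrow> real \<Rightarrow> real \<Rightarrow> (real \<Rightarrow> real) \<Rightarrow> bool" where
  "delta_integrable T a b h \<longleftrightarrow> set_integrable (delta_measure T) ({a..<b} \<inter> T) h"

definition delta_integral :: "real set \<Rightarrow> real \<Rightarrow> real \<Rightarrow> (real \<Rightarrow> real) \<Rightarrow> real" where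
  "delta_integral T a b h = (LINT s:{a..<b} \<inter> T|delta_measure T. h s)"

definition nabla_integrable :: "real set \<Rightarrow> real \<Rightarrow> real \<Rightarrow> (real \<Rightarrow> real) \<Rightarrow> bool" where
  "nabla_integrable T a b h \<longleftrightarrow> set_integrable (nabla_measure T) ({a<..b} \<inter> T) h"

definition nabla_integral :: "real set \<Rightarrow> real \<Rightarrow> real \<Rightarrow> (real \<Rightarrow> real) \<Rightarrow> real" where
  "nabla_integral T a b h = (LINT s:{a<..b} \<inter> T|nabla_measure T. h s)"

definition diamond_integrable :: "real set \<Rightarrow> real \<Rightarrow> real \<Rightarrow> (real \<Rightarrow> real) \<Rightarrow> bool" where
  "diamond_integrable T a b h \<longleftrightarrow> delta_integrable T a b h \<and> nabla_integrable T a b h"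

definition diamond_integral :: "real set \<Rightarrow> real \<Rightarrow> real \<Rightarrow> real \<Rightarrow> (real \<Rightarrow> real) \<Rightarrow> real" where
  "diamond_integral T \<alpha> a b h = \<alpha> * delta_integral T a b h + (1 - \<alpha>) * nabla_integral T a b h"

definition kernel_op_exists ::
  "real set \<Rightarrow> real \<Rightarrow> (real \<Rightarrow> real \<Rightarrow> real) \<Rightarrow> (real \<Rightarrow> real) \<Rightarrow> real \<Rightarrow> bool" where
  "kernel_op_exists T a K h t \<longleftrightarrow> diamond_integrable T a t (\<lambda>s. K t s * h s)"

definition kernel_op ::
  "real set \<Rightarrow> real \<Rightarrow> real \<Rightarrow> (real \<Rightarrow> real \<Rightarrow> real) \<Rightarrow> (real \<Rightarrow> real) \<Rightarrow> real \<Rightarrow> real" where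
  "kernel_op T \<alpha> a K h t = diamond_integral T \<alpha> a t (\<lambda>s. K t s * h s)"


text \<open>
  \<open>ts_outer\<close> is an outer measure, so \<^const>\<open>measure_of\<close> does not fall back to the zero measure,
  and half-open intervals are measurable with measure equal to their length.
\<close>

abbreviation (input) half_open :: "(real \<Rightarrow> real \<Rightarrow> real set) \<Rightarrow> bool" where
  "half_open J \<equiv> J = atLeastLessThan \<or> J = greaterThanAtMost"

lemma ts_outer_le:
  assumes "p \<in> ts_cover J T X"
  shows "ts_outer J T X \<le> (\<Sum>i. ennreal (snd (p i) - fst (p i)))"
  unfolding ts_outer_def by (rule INF_lower[OF assms])

lemma ts_outer_mono: "X \<subseteq> Y \<Longrightarrow> ts_outer J T X \<le> ts_outer J T Y"
  unfolding ts_outer_def by (rule INF_superset_mono) (auto simp: ts_cover_def)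

lemma ts_outer_empty:
  assumes "T \<noteq> {}"
  shows "ts_outer J T {} = 0"
proof -
  obtain c where "c \<in> T" using assms by auto
  then have "(\<lambda>_. (c, c)) \<in> ts_cover J T {}" by (auto simp: ts_cover_def)
  from ts_outer_le[OF this] show ?thesis by simp
qed

lemma ts_outer_UN_le: "ts_outer J T (\<Union>i. A i) \<le> (\<Sum>i. ts_outer J T (A i))"
proof (rule ennreal_le_epsilon)
  fix e :: real
  assume fin: "(\<Sum>i. ts_outer J T (A i)) < top" and e: "0 < e"
  define d where "d i = e * (1/2) ^ Suc i" for i
  have dpos: "d i > 0" for i using e by (simp add: d_def)
  have "(\<Sum>i. ennreal (d i)) = ennreal e"
  proof -
    have "d sums (e * 1)"
      unfolding d_def using power_half_series by (rule sums_mult)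
    then show ?thesis
      by (metis dpos less_imp_le mult.right_neutral suminf_ennreal_eq)
  qed
  have "\<exists>p \<in> ts_cover J T (A i). (\<Sum>n. ennreal (snd (p n) - fst (p n))) < ts_outer J T (A i) + d i" for i
  proof (rule INF_approx_ennreal[OF dpos])
    show "ts_outer J T (A i) = (INF p\<in>ts_cover J T (A i). \<Sum>n. ennreal (snd (p n) - fst (p n)))"
      by (simp add: ts_outer_def)
    have "ts_outer J T (A i) \<le> (\<Sum>i. ts_outer J T (A i))"
      using sum_le_suminf[of "\<lambda>i. ts_outer J T (A i)" "{i}"] by simp
    then show "ts_outer J T (A i) \<noteq> \<infinity>"
      using fin by (auto simp: top_unique)
  qed
  then obtain p where p: "\<And>i. p i \<in> ts_cover J T (A i)"
    and pl: "\<And>i. (\<Sum>n. ennreal (snd (p i n) - fst (p i n))) < ts_outer J T (A i) + d i"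
    by metis
  define q where "q k = (case prod_decode k of (i, n) \<Rightarrow> p i n)" for k
  have "q \<in> ts_cover J T (\<Union>i. A i)"
  proof -
    have "\<exists>k. x \<in> J (fst (q k)) (snd (q k)) \<inter> T" if x: "x \<in> A i" for x i
    proof -
      obtain n where "x \<in> J (fst (p i n)) (snd (p i n)) \<inter> T"
        using p[of i] x unfolding ts_cover_def by blast
      then show ?thesis
        by (intro exI[of _ "prod_encode (i, n)"]) (simp add: q_def)
    qed
    moreover have "fst (q k) \<in> T \<and> snd (q k) \<in> T \<and> fst (q k) \<le> snd (q k)" for k
      using p by (auto simp: ts_cover_def q_def split: prod.splits)
    ultimately show ?thesis by (auto simp: ts_cover_def)
  qed
  from ts_outer_le[OF this]
  have "ts_outer J T (\<Union>i. A i) \<le> (\<Sum>k. ennreal (snd (q k) - fst (q k)))" .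
  also have "\<dots> = (\<Sum>i. \<Sum>n. ennreal (snd (p i n) - fst (p i n)))"
    using suminf_ennreal_2dimen[of "\<lambda>i. \<Sum>n. ennreal (snd (p i n) - fst (p i n))"
        "\<lambda>(i, n). ennreal (snd (p i n) - fst (p i n))"]
    by (simp add: q_def case_prod_unfold)
  also have "\<dots> \<le> (\<Sum>i. ts_outer J T (A i) + d i)"
    by (intro suminf_le less_imp_le pl) auto
  also have "\<dots> = (\<Sum>i. ts_outer J T (A i)) + (\<Sum>i. ennreal (d i))"
    by (simp add: suminf_add)
  finally show "ts_outer J T (\<Union>i. A i) \<le> (\<Sum>i. ts_outer J T (A i)) + ennreal e"
    using \<open>(\<Sum>i. ennreal (d i)) = ennreal e\<close> by simp
qed

lemma ts_outer_space:
  assumes "T \<noteq> {}"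
  shows "outer_measure_space (Pow T) (ts_outer J T)"
  using ts_outer_UN_le[of J T]
  by (auto simp: outer_measure_space_def positive_def increasing_def countably_subadditive_def
      ts_outer_empty[OF assms] intro: ts_outer_mono)

lemma measure_space_ts:
  assumes "T \<noteq> {}"
  shows "measure_space T (lambda_system T (Pow T) (ts_outer J T)) (ts_outer J T)"
  by (intro sigma_algebra.caratheodory_lemma sigma_algebra_Pow ts_outer_space assms)

lemma
  assumes "T \<noteq> {}"
  shows space_ts_measure: "space (ts_measure J T) = T"
    and sets_ts_measure: "sets (ts_measure J T) = lambda_system T (Pow T) (ts_outer J T)"
    and emeasure_ts_measure:
      "A \<in> lambda_system T (Pow T) (ts_outer J T) \<Longrightarrow> emeasure (ts_measure J T) A = ts_outer J T A"
proof -
  interpret s: sigma_algebra T "lambda_system T (Pow T) (ts_outer J T)"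
    using measure_space_ts[OF assms, of J] by (simp add: measure_space_def)
  show "space (ts_measure J T) = T"
    unfolding ts_measure_def by (rule space_measure_of) (auto simp: lambda_system_def)
  show S: "sets (ts_measure J T) = lambda_system T (Pow T) (ts_outer J T)"
    unfolding ts_measure_def by (rule s.sets_measure_of_eq)
  show "emeasure (ts_measure J T) A = ts_outer J T A"
    if A: "A \<in> lambda_system T (Pow T) (ts_outer J T)"
    using measure_space_ts[OF assms, of J] A unfolding measure_space_def
    by (intro emeasure_measure_of[OF ts_measure_def]) (auto simp: S lambda_system_def)
qed

lemma interval_in_lambda_system:
  assumes J: "half_open J" and c: "c \<in> T" and d: "d \<in> T" and cd: "c \<le> d"
  shows "J c d \<inter> T \<in> lambda_system T (Pow T) (ts_outer J T)"
proof -
  have T: "T \<noteq> {}" using c by auto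
  have le: "ts_outer J T (J c d \<inter> T \<inter> X) + ts_outer J T ((T - J c d \<inter> T) \<inter> X) \<le> ts_outer J T X"
    if X: "X \<subseteq> T" for X
    unfolding ts_outer_def[of J T X]
  proof (rule INF_greatest)
    fix p assume p: "p \<in> ts_cover J T X"
    let ?l = "\<lambda>p. \<Sum>i. ennreal (snd (p i) - fst (p i))"
    define p1 where "p1 i = (max c (min d (fst (p i))), max c (min d (snd (p i))))" for i :: nat
    define p2 where "p2 i = (min c (fst (p i)), min c (snd (p i)))" for i :: nat
    define p3 where "p3 i = (max d (fst (p i)), max d (snd (p i)))" for i :: nat
    define q where "q k = (if even k then p2 (k div 2) else p3 (k div 2))" for k
    have pT: "fst (p i) \<in> T" "snd (p i) \<in> T" "fst (p i) \<le> snd (p i)" for i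
      using p by (auto simp: ts_cover_def)
    have T123: "fst (r i) \<in> T \<and> snd (r i) \<in> T \<and> fst (r i) \<le> snd (r i)"
      if "r = p1 \<or> r = p2 \<or> r = p3" for r i
      using that pT[of i] c d by (auto simp: p1_def p2_def p3_def min_def max_def)
    have cov: "\<exists>i. x \<in> J (fst (p i)) (snd (p i))" if "x \<in> X" for x
      using p that by (auto simp: ts_cover_def)
    have c1: "p1 \<in> ts_cover J T (J c d \<inter> T \<inter> X)"
    proof -
      have "\<exists>i. x \<in> J (fst (p1 i)) (snd (p1 i))" if "x \<in> X" "x \<in> J c d" for x
      proof -
        obtain i where "x \<in> J (fst (p i)) (snd (p i))" using cov \<open>x \<in> X\<close> by blast
        then have "x \<in> J (fst (p1 i)) (snd (p1 i))"
          using J that(2) by (auto simp: p1_def)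
        then show ?thesis ..
      qed
      then show ?thesis using T123 by (auto simp: ts_cover_def)
    qed
    have c2: "p2 \<in> ts_cover J T (X \<inter> {x. \<exists>y. x \<in> J y c})"
    proof -
      have "\<exists>i. x \<in> J (fst (p2 i)) (snd (p2 i))" if "x \<in> X" "x \<in> J y c" for x y
      proof -
        obtain i where "x \<in> J (fst (p i)) (snd (p i))" using cov \<open>x \<in> X\<close> by blast
        then have "x \<in> J (fst (p2 i)) (snd (p2 i))"
          using J that(2) by (auto simp: p2_def)
        then show ?thesis ..
      qed
      then show ?thesis using T123 X by (auto simp: ts_cover_def)
    qed
    have c3: "p3 \<in> ts_cover J T (X \<inter> {x. \<exists>y. x \<in> J d y})"
    proof -
      have "\<exists>i. x \<in> J (fst (p3 i)) (snd (p3 i))" if "x \<in> X" "x \<in> J d y" for x y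
      proof -
        obtain i where "x \<in> J (fst (p i)) (snd (p i))" using cov \<open>x \<in> X\<close> by blast
        then have "x \<in> J (fst (p3 i)) (snd (p3 i))"
          using J that(2) by (auto simp: p3_def)
        then show ?thesis ..
      qed
      then show ?thesis using T123 X by (auto simp: ts_cover_def)
    qed
    let ?A = "X \<inter> {x. \<exists>y. x \<in> J y c}" and ?B = "X \<inter> {x. \<exists>y. x \<in> J d y}"
    have split: "(T - J c d \<inter> T) \<inter> X \<subseteq> ?A \<union> ?B"
    proof
      fix x assume x: "x \<in> (T - J c d \<inter> T) \<inter> X"
      have "x \<in> J x c \<or> x \<in> J d (x+1) \<or> x \<in> J (x-1) c \<or> x \<in> J d x"
        using J x by auto
      then show "x \<in> ?A \<union> ?B" using x by blast
    qed
    have sub: "subadditive (Pow T) (ts_outer J T)"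
      using ts_outer_space[OF T, of J] sigma_algebra_Pow[of T]
      by (auto simp: outer_measure_space_def
          intro!: ring_of_sets.countably_subadditive_subadditive algebra.axioms(1)
            sigma_algebra.axioms(1))
    have AB: "ts_outer J T ((T - J c d \<inter> T) \<inter> X) \<le> ts_outer J T ?A + ts_outer J T ?B"
    proof -
      have e: "?B - ?A \<subseteq> ?B" by blast
      have "ts_outer J T ((T - J c d \<inter> T) \<inter> X) \<le> ts_outer J T (?A \<union> (?B - ?A))"
        using split by (intro ts_outer_mono) auto
      also have "\<dots> \<le> ts_outer J T ?A + ts_outer J T (?B - ?A)"
        using X by (intro subadditiveD[OF sub]) auto
      also have "\<dots> \<le> ts_outer J T ?A + ts_outer J T ?B"
        by (intro add_left_mono ts_outer_mono e)
      finally show ?thesis .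
    qed
    have "ts_outer J T (J c d \<inter> T \<inter> X) + ts_outer J T ((T - J c d \<inter> T) \<inter> X)
        \<le> ?l p1 + (?l p2 + ?l p3)"
      using AB ts_outer_le[OF c1] ts_outer_le[OF c2] ts_outer_le[OF c3]
      by (meson add_mono order_trans)
    also have "\<dots> = (\<Sum>i. ennreal (snd (p1 i) - fst (p1 i)) +
        (ennreal (snd (p2 i) - fst (p2 i)) + ennreal (snd (p3 i) - fst (p3 i))))"
      by (simp add: suminf_add)
    also have "\<dots> = ?l p"
    proof (intro arg_cong[where f=suminf] ext)
      fix i
      have "snd (p i) - fst (p i) = (snd (p1 i) - fst (p1 i)) +
          ((snd (p2 i) - fst (p2 i)) + (snd (p3 i) - fst (p3 i)))"
        using cd by (simp add: p1_def p2_def p3_def max_def min_def)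
      then show "ennreal (snd (p1 i) - fst (p1 i)) +
          (ennreal (snd (p2 i) - fst (p2 i)) + ennreal (snd (p3 i) - fst (p3 i)))
        = ennreal (snd (p i) - fst (p i))"
        using T123[of p1 i] T123[of p2 i] T123[of p3 i] by (simp flip: ennreal_plus)
    qed
    finally show "ts_outer J T (J c d \<inter> T \<inter> X) + ts_outer J T ((T - J c d \<inter> T) \<inter> X) \<le> ?l p" .
  qed
  have ge: "ts_outer J T X \<le> ts_outer J T (J c d \<inter> T \<inter> X) + ts_outer J T ((T - J c d \<inter> T) \<inter> X)"
    if X: "X \<subseteq> T" for X
  proof -
    have sub: "subadditive (Pow T) (ts_outer J T)"
      using ts_outer_space[OF T, of J] sigma_algebra_Pow[of T]
      by (auto simp: outer_measure_space_def
          intro!: ring_of_sets.countably_subadditive_subadditive algebra.axioms(1)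
            sigma_algebra.axioms(1))
    have "ts_outer J T X \<le> ts_outer J T ((J c d \<inter> T \<inter> X) \<union> ((T - J c d \<inter> T) \<inter> X))"
      using X by (intro ts_outer_mono) auto
    also have "\<dots> \<le> ts_outer J T (J c d \<inter> T \<inter> X) + ts_outer J T ((T - J c d \<inter> T) \<inter> X)"
      by (intro subadditiveD[OF sub]) auto
    finally show ?thesis .
  qed
  show ?thesis
    using le ge by (auto simp: lambda_system_def intro!: antisym)
qed

lemma ts_outer_interval:
  assumes T: "closed T" and J: "half_open J" and c: "c \<in> T" and d: "d \<in> T" and cd: "c \<le> d"
  shows "ts_outer J T (J c d \<inter> T) = ennreal (d - c)"
proof (rule antisym)
  define p where "p i = (if i = 0 then (c, d) else (c, c))" for i :: nat
  have "p \<in> ts_cover J T (J c d \<inter> T)"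
    using c d cd by (auto simp: p_def ts_cover_def intro!: exI[of _ 0])
  from ts_outer_le[OF this]
  have "ts_outer J T (J c d \<inter> T) \<le> (\<Sum>i. ennreal (snd (p i) - fst (p i)))" .
  also have "\<dots> = ennreal (d - c)"
    by (subst suminf_finite[of "{0}"]) (auto simp: p_def)
  finally show "ts_outer J T (J c d \<inter> T) \<le> ennreal (d - c)" .
next
  show "ennreal (d - c) \<le> ts_outer J T (J c d \<inter> T)"
    unfolding ts_outer_def
  proof (rule INF_greatest)
    fix p assume p: "p \<in> ts_cover J T (J c d \<inter> T)"
    then have pT: "fst (p i) \<in> T" "snd (p i) \<in> T" "fst (p i) \<le> snd (p i)" for i
      by (auto simp: ts_cover_def)
    have cov: "\<exists>i. s \<in> J (fst (p i)) (snd (p i))" if "s \<in> J c d" "s \<in> T" for s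
      using p that by (auto simp: ts_cover_def)
    have sub: "J c d \<subseteq> (\<Union>i. J (fst (p i)) (snd (p i)))"
    proof
      fix r assume r: "r \<in> J c d"
      then have cr: "c \<le> r" "r \<le> d" using J by auto
      from J show "r \<in> (\<Union>i. J (fst (p i)) (snd (p i)))"
      proof
        assume J: "J = atLeastLessThan"
        have "compact (T \<inter> {c..r})" using T by (simp add: closed_Int_compact)
        moreover have "T \<inter> {c..r} \<noteq> {}" using c cr by auto
        ultimately obtain s where sT: "s \<in> T \<inter> {c..r}"
          and sup: "\<And>u. u \<in> T \<inter> {c..r} \<Longrightarrow> u \<le> s"
          using compact_attains_sup by metis
        obtain i where i: "s \<in> J (fst (p i)) (snd (p i))"
          using cov[of s] sT r J by auto
        have "r < snd (p i)"
          using sup[of "snd (p i)"] pT[of i] i sT J by force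
        then show ?thesis using i sT J by (auto intro!: exI[of _ i])
      next
        assume J: "J = greaterThanAtMost"
        have "compact (T \<inter> {r..d})" using T by (simp add: closed_Int_compact)
        moreover have "T \<inter> {r..d} \<noteq> {}" using d cr by auto
        ultimately obtain s where sT: "s \<in> T \<inter> {r..d}"
          and inf: "\<And>u. u \<in> T \<inter> {r..d} \<Longrightarrow> s \<le> u"
          using compact_attains_inf by metis
        obtain i where i: "s \<in> J (fst (p i)) (snd (p i))"
          using cov[of s] sT r J by auto
        have "fst (p i) < r"
          using inf[of "fst (p i)"] pT[of i] i sT J by force
        then show ?thesis using i sT J by (auto intro!: exI[of _ i])
      qed
    qed
    have em: "emeasure lborel (J x y) = ennreal (y - x)" "J x y \<in> sets lborel" if "x \<le> y" for x y
      using J that by auto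
    have "ennreal (d - c) = emeasure lborel (J c d)"
      using em(1)[OF cd] by simp
    also have "\<dots> \<le> emeasure lborel (\<Union>i. J (fst (p i)) (snd (p i)))"
      using em(2)[OF pT(3)] by (intro emeasure_mono sub sets.countable_UN) auto
    also have "\<dots> \<le> (\<Sum>i. emeasure lborel (J (fst (p i)) (snd (p i))))"
      using em(2)[OF pT(3)] by (intro emeasure_subadditive_countably) auto
    also have "\<dots> = (\<Sum>i. ennreal (snd (p i) - fst (p i)))"
      using em(1)[OF pT(3)] by simp
    finally show "ennreal (d - c) \<le> (\<Sum>i. ennreal (snd (p i) - fst (p i)))" .
  qed
qed

lemma delta_measure_interval:
  assumes "time_scale T" "c \<in> T" "d \<in> T" "c \<le> d"
  shows "{c..<d} \<inter> T \<in> sets (delta_measure T)"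
    and "emeasure (delta_measure T) ({c..<d} \<inter> T) = ennreal (d - c)"
  using assms interval_in_lambda_system[of atLeastLessThan c T d]
    ts_outer_interval[of T atLeastLessThan c d]
  by (simp_all add: time_scale_def delta_measure_def sets_ts_measure emeasure_ts_measure)

lemma nabla_measure_interval:
  assumes "time_scale T" "c \<in> T" "d \<in> T" "c \<le> d"
  shows "{c<..d} \<inter> T \<in> sets (nabla_measure T)"
    and "emeasure (nabla_measure T) ({c<..d} \<inter> T) = ennreal (d - c)"
  using assms interval_in_lambda_system[of greaterThanAtMost c T d]
    ts_outer_interval[of T greaterThanAtMost c d]
  by (simp_all add: time_scale_def nabla_measure_def sets_ts_measure emeasure_ts_measure)

end

theory Submission
  imports Defs
begin

text \<open>
  From \<open>(M\<bar>g\<bar> - \<bar>f\<bar>)(\<bar>f\<bar> - m\<bar>g\<bar>) \<ge> 0\<close> one gets \<open>f\<^sup>2 \<le> (m + M)\<bar>f\<bar>\<bar>g\<bar> - mM g\<^sup>2\<close>. Multiplying by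
  \<open>K\<bar>w\<bar>\<close> and integrating gives \<open>A \<le> (m + M) C - mM B\<close> for the integrals \<open>A\<close>, \<open>B\<close>, \<open>C\<close> with
  \<open>f\<^sup>2\<close>, \<open>g\<^sup>2\<close>, \<open>\<bar>f\<bar>\<bar>g\<bar>\<close> (the Diaz--Metcalf inequality). Hence
  \<open>A B - C\<^sup>2 \<le> (m + M) B C - mM B\<^sup>2 - C\<^sup>2\<close>, a quadratic in \<open>C\<close> with maximum
  \<open>(M - m)\<^sup>2 B\<^sup>2 / 4\<close>; this even has \<open>1/4\<close> in place of \<open>1/2\<close>.
\<close>

text \<open>The delta part lives on \<open>{a..<b}\<close> and the nabla part on
  \<open>{a<..b}\<close>, so the sign condition is stated on \<open>{a..b}\<close>, which covers
  both. A non-integrable \<open>h\<close> contributes the default value 0, which agrees with the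
  claim.\<close>

lemma diamond_integral_nonneg:
  assumes "0 \<le> \<alpha>" "\<alpha> \<le> 1" "\<And>s. s \<in> {a..b} \<inter> T \<Longrightarrow> 0 \<le> h s"
  shows "0 \<le> diamond_integral T \<alpha> a b h"
  using assms unfolding diamond_integral_def delta_integral_def nabla_integral_def
  by (auto intro!: add_nonneg_nonneg mult_nonneg_nonneg integral_nonneg_AE
      simp: set_lebesgue_integral_def indicator_def)

lemma diamond_integral_mono:
  assumes "0 \<le> \<alpha>" "\<alpha> \<le> 1" "diamond_integrable T a b h" "diamond_integrable T a b k"
    and "\<And>s. s \<in> {a..b} \<inter> T \<Longrightarrow> h s \<le> k s"
  shows "diamond_integral T \<alpha> a b h \<le> diamond_integral T \<alpha> a b k"
  using assms
  unfolding diamond_integral_def delta_integral_def nabla_integral_def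
    diamond_integrable_def delta_integrable_def nabla_integrable_def
  by (intro add_mono mult_left_mono set_integral_mono) auto

text \<open>The difference form matches the right side of the pointwise bound, with
  \<open>c = m + M\<close> and \<open>d = m * M\<close>.\<close>

lemma diamond_integrable_lincomb:
  assumes "diamond_integrable T a b h" "diamond_integrable T a b k"
  shows "diamond_integrable T a b (\<lambda>s. c * h s - d * k s)"
  using assms
  unfolding diamond_integrable_def delta_integrable_def nabla_integrable_def
  by auto

lemma diamond_integral_lincomb:
  assumes "diamond_integrable T a b h" "diamond_integrable T a b k"
  shows "diamond_integral T \<alpha> a b (\<lambda>s. c * h s - d * k s)
    = c * diamond_integral T \<alpha> a b h - d * diamond_integral T \<alpha> a b k"
  using assms
  unfolding diamond_integral_def delta_integral_def nabla_integral_def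
    diamond_integrable_def delta_integrable_def nabla_integrable_def
  by (simp add: algebra_simps)

lemma square_le_of_ratio_bounds:
  fixes x y m M :: real
  assumes "0 < y" "m \<le> x / y" "x / y \<le> M"
  shows "x\<^sup>2 \<le> (m + M) * (x * y) - m * M * y\<^sup>2"
proof -
  have "0 \<le> (M * y - x) * (x - m * y)"
    using assms by (intro mult_nonneg_nonneg) (auto simp: field_simps)
  then show ?thesis by (simp add: algebra_simps power2_eq_square)
qed

lemma reverse_Cauchy_Schwarz_quadratic:
  fixes A B C m M :: real
  assumes "0 \<le> B" "A \<le> (m + M) * C - m * M * B"
  shows "A * B - C\<^sup>2 \<le> 1 / 4 * (M - m)\<^sup>2 * B\<^sup>2"
proof -
  have "A * B \<le> ((m + M) * C - m * M * B) * B"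
    using assms by (intro mult_right_mono) auto
  \<comment> \<open>Completing the square in \<open>C\<close>: the coefficients of
    \<open>B\<^sup>2\<close> match because
    \<open>(M - m)\<^sup>2 + 4 * m * M = (m + M)\<^sup>2\<close>.\<close>
  moreover have "1 / 4 * (M - m)\<^sup>2 * B\<^sup>2 - ((m + M) * C - m * M * B) * B + C\<^sup>2
      = ((m + M) * B / 2 - C)\<^sup>2"
    by (simp add: power2_eq_square field_simps)
  moreover have "0 \<le> ((m + M) * B / 2 - C)\<^sup>2" by simp
  ultimately show ?thesis by linarith
qed

theorem corollary3p6:
  fixes T :: "real set" and a b t \<alpha> m M :: real
    and w f g :: "real \<Rightarrow> real" and K :: "real \<Rightarrow> real \<Rightarrow> real"
  assumes "time_scale T"
    and "a \<in> T" and "b \<in> T" and "a < b"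
    and "t \<in> {a<..b} \<inter> T"
    and "0 \<le> \<alpha>" and "\<alpha> \<le> 1"
    and "continuous_on ({a..b} \<inter> T) w"
    and "continuous_on ({a..b} \<inter> T) f"
    and "continuous_on ({a..b} \<inter> T) g"
    and "diamond_integrable T a b w"
    and "diamond_integrable T a b f"
    and "diamond_integrable T a b g"
    and "\<And>r s. r \<in> {a..b} \<inter> T \<Longrightarrow> s \<in> {a..b} \<inter> T \<Longrightarrow> 0 \<le> K r s"
    and "kernel_op_exists T a K (\<lambda>s. \<bar>w s\<bar> * \<bar>f s\<bar>^2) t"
    and "kernel_op_exists T a K (\<lambda>s. \<bar>w s\<bar> * \<bar>g s\<bar>^2) t"
    and "kernel_op_exists T a K (\<lambda>s. \<bar>w s\<bar> * \<bar>f s\<bar> * \<bar>g s\<bar>) t"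
    and "0 < m" and "0 < M"
    and "\<And>s. s \<in> {a..t} \<inter> T \<Longrightarrow> g s \<noteq> 0 \<and> m \<le> \<bar>f s\<bar> / \<bar>g s\<bar> \<and> \<bar>f s\<bar> / \<bar>g s\<bar> \<le> M"
  shows "kernel_op T \<alpha> a K (\<lambda>s. \<bar>w s\<bar> * \<bar>f s\<bar>^2) t * kernel_op T \<alpha> a K (\<lambda>s. \<bar>w s\<bar> * \<bar>g s\<bar>^2) t
           - (kernel_op T \<alpha> a K (\<lambda>s. \<bar>w s\<bar> * \<bar>f s\<bar> * \<bar>g s\<bar>) t)^2
         \<le> 1 / 2 * (M - m)^2 * (kernel_op T \<alpha> a K (\<lambda>s. \<bar>w s\<bar> * \<bar>g s\<bar>^2) t)^2"
proof -
  let ?F = "\<lambda>s. K t s * (\<bar>w s\<bar> * \<bar>f s\<bar>^2)" and ?G = "\<lambda>s. K t s * (\<bar>w s\<bar> * \<bar>g s\<bar>^2)"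
    and ?H = "\<lambda>s. K t s * (\<bar>w s\<bar> * \<bar>f s\<bar> * \<bar>g s\<bar>)"
  \<comment> \<open>Since \<open>t \<le> b\<close>, both \<open>t\<close> and \<open>s\<close> lie
    in \<open>{a..b}\<close>, where the kernel is nonnegative.\<close>
  have K: "0 \<le> K t s" if "s \<in> {a..t} \<inter> T" for s
    using that assms(5) by (intro assms(14)) auto
  have int: "diamond_integrable T a t ?F" "diamond_integrable T a t ?G"
    "diamond_integrable T a t ?H"
    using assms(15-17) by (simp_all add: kernel_op_exists_def)
  have B: "0 \<le> diamond_integral T \<alpha> a t ?G"
    using K assms(6,7) by (intro diamond_integral_nonneg) auto
  have "?F s \<le> (m + M) * ?H s - m * M * ?G s" if s: "s \<in> {a..t} \<inter> T" for s
  proof -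
    \<comment> \<open>The ratio bound for \<open>x = \<bar>f s\<bar>\<close> and
      \<open>y = \<bar>g s\<bar>\<close>, multiplied by the nonnegative weight
      \<open>K t s * \<bar>w s\<bar>\<close>.\<close>
    have "K t s * \<bar>w s\<bar> * \<bar>f s\<bar>\<^sup>2
        \<le> K t s * \<bar>w s\<bar> * ((m + M) * (\<bar>f s\<bar> * \<bar>g s\<bar>) - m * M * \<bar>g s\<bar>\<^sup>2)"
      using assms(20)[OF s] K[OF s]
      by (intro mult_left_mono square_le_of_ratio_bounds) auto
    then show ?thesis by (simp add: algebra_simps)
  qed
  then have "diamond_integral T \<alpha> a t ?F
      \<le> diamond_integral T \<alpha> a t (\<lambda>s. (m + M) * ?H s - m * M * ?G s)"
    by (intro diamond_integral_mono diamond_integrable_lincomb int assms(6,7))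
  also have "\<dots> = (m + M) * diamond_integral T \<alpha> a t ?H - m * M * diamond_integral T \<alpha> a t ?G"
    by (rule diamond_integral_lincomb[OF int(3,2)])
  finally have "diamond_integral T \<alpha> a t ?F * diamond_integral T \<alpha> a t ?G
      - (diamond_integral T \<alpha> a t ?H)\<^sup>2 \<le> 1 / 4 * (M - m)\<^sup>2 * (diamond_integral T \<alpha> a t ?G)\<^sup>2"
    by (rule reverse_Cauchy_Schwarz_quadratic[OF B])
  also have "\<dots> \<le> 1 / 2 * (M - m)\<^sup>2 * (diamond_integral T \<alpha> a t ?G)\<^sup>2"
    by (intro mult_right_mono) auto
  finally show ?thesis by (simp add: kernel_op_def)
qed

end
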